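(* Let $I\subset\mathbb{R}$ be a nonempty open interval and assume the following. (i) $(T,\mathscr{A},\mu)$ is a measure space. (ii) $\Lambda:T\times\Delta^\circ(I)\to\mathbb{R}_+$ is integrable (with respect to $\mu$) in its first variable. (iii) $M:T\times\Delta^\circ(I)\to\mathbb{R}$ is measurable in its first variable and, for all $t\in T$, the map $(x,y)\mapsto M(t,x,y)$ is a two-variable mean on $I$; $M_0:\Delta^\circ(I)\to I$ is a strict mean. (iv) $(\omega_0,\omega_1)$ is a Chebyshev system on $I$ such that $\omega_0$ is positive and, for $i\in\{0,1\}$, $$\omega_i(M_0(x,y))=\int_T\Lambda(t,x,y)\,\omega_i(M(t,x,y))\,d\mu(t)\qquad((x,y)\in\Delta^\circ(I)).$$ Let $f:I\to\mathbb{R}$ be a locally bounded Borel measurable function satisfying, for all $(x,y)\in\Delta^\circ(I)$, $$f(u)\le\frac{\Omega(u,y)}{\Omega(x,y)}f(x)+\frac{\Omega(x,u)}{\Omega(x,y)}f(y)+\varepsilon_{x,y}(u)\qquad(u\in[x,y]),$$ where, for all $(x,y)\in\Delta^\circ(I)$, $\varepsilon_{x,y}:[x,y]\to\mathbb{R}$ is a bounded and Borel measurable function. Then, for all $(x,y)\in\Delta^\circ(I)$, $f$ also satisfies $$\int_T\Lambda(t,x,y)f(M(t,x,y))\,d\mu(t)\le\frac{\Omega(M_0(x,y),y)}{\Omega(x,y)}f(x)+\frac{\Omega(x,M_0(x,y))}{\Omega(x,y)}f(y)+E(x,y),$$ with $E:\Delta^\circ(I)\to\mathbb{R}$ defined by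 $$E(x,y)=\int_T\Lambda(t,x,y)\,\varepsilon_{x,y}(M(t,x,y))\,d\mu(t).$$
   Context: $\mathbb{R}_+$ is the set of nonnegative reals. $\Delta^\circ(I)=\{(x,y)\in I\times I\mid x<y\}$. A pair $(\omega_0,\omega_1)$ of continuous functions $I\to\mathbb{R}$ is a Chebyshev system over $I$ if $\Omega(x,y):=\omega_0(x)\omega_1(y)-\omega_0(y)\omega_1(x)>0$ for all $(x,y)\in\Delta^\circ(I)$; the same formula defines $\Omega(x,y)$ for all $x,y\in I$. A map $N$ on $\Delta^\circ(I)$ is a (two-variable) mean if $x\le N(x,y)\le y$ for all $(x,y)\in\Delta^\circ(I)$, and a strict mean if $x<N(x,y)<y$ for all $(x,y)\in\Delta^\circ(I)$. "In its first variable" means for each fixed $(x,y)\in\Delta^\circ(I)$ as a function of $t\in T$. *)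

theory Defs
  imports "HOL-Analysis.Analysis"
begin

definition open_triangle :: "real set \<Rightarrow> (real \<times> real) set" where
  "open_triangle I = {(x, y). x \<in> I \<and> y \<in> I \<and> x < y}"

definition Omega :: "(real \<Rightarrow> real) \<Rightarrow> (real \<Rightarrow> real) \<Rightarrow> real \<Rightarrow> real \<Rightarrow> real" where
  "Omega \<omega>\<^sub>0 \<omega>\<^sub>1 x y = \<omega>\<^sub>0 x * \<omega>\<^sub>1 y - \<omega>\<^sub>0 y * \<omega>\<^sub>1 x"

definition chebyshev_system_on :: "real set \<Rightarrow> (real \<Rightarrow> real) \<Rightarrow> (real \<Rightarrow> real) \<Rightarrow> bool" where
  "chebyshev_system_on I \<omega>\<^sub>0 \<omega>\<^sub>1 \<longleftrightarrow>
     continuous_on I \<omega>\<^sub>0 \<and> continuous_on I \<omega>\<^sub>1 \<and>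
     (\<forall>(x, y) \<in> open_triangle I. Omega \<omega>\<^sub>0 \<omega>\<^sub>1 x y > 0)"

definition mean_on :: "real set \<Rightarrow> (real \<Rightarrow> real \<Rightarrow> real) \<Rightarrow> bool" where
  "mean_on I N \<longleftrightarrow> (\<forall>(x, y) \<in> open_triangle I. x \<le> N x y \<and> N x y \<le> y)"

text \<open>For an interval \<open>I\<close>, the values of a mean on \<open>open_triangle I\<close> automatically lie in \<open>I\<close>.\<close>

definition strict_mean_on :: "real set \<Rightarrow> (real \<Rightarrow> real \<Rightarrow> real) \<Rightarrow> bool" where
  "strict_mean_on I N \<longleftrightarrow> (\<forall>(x, y) \<in> open_triangle I. x < N x y \<and> N x y < y)"

definition locally_bounded_on :: "real set \<Rightarrow> (real \<Rightarrow> real) \<Rightarrow> bool" where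
  "locally_bounded_on S f \<longleftrightarrow> (\<forall>p\<in>S. \<exists>U. open U \<and> p \<in> U \<and> bounded (f ` (U \<inter> S)))"

end

theory Submission
  imports Defs
begin

text \<open>
  As a function of \<open>u\<close>, the right-hand side of the convexity inequality without the error term is a
  linear combination of \<open>\<omega>\<^sub>0\<close> and \<open>\<omega>\<^sub>1\<close>. Substituting \<open>u = M t x y\<close>, multiplying by \<open>\<Lambda> t x y\<close> and
  integrating therefore replaces \<open>u\<close> by \<open>M\<^sub>0 x y\<close> in that combination. All integrands are integrable,
  being products of \<open>\<Lambda>\<close> with bounded measurable functions.
\<close>

text \<open>Finitely many of the neighbourhoods given by local boundedness cover \<open>K\<close>,
  and a finite union of bounded sets is bounded. This matters because \<open>f\<close> may be
  unbounded near the ends of the open interval \<open>I\<close>, whereas the integrals only see its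
  values on a compact \<open>{x..y}\<close>.\<close>

lemma locally_bounded_on_compact_imp_bounded:
  assumes "locally_bounded_on S f" "compact K" "K \<subseteq> S"
  shows "bounded (f ` K)"
proof -
  have "\<forall>p\<in>S. \<exists>U. open U \<and> p \<in> U \<and> bounded (f ` (U \<inter> S))"
    using assms(1) by (simp add: locally_bounded_on_def)
  then obtain U where U: "\<And>p. p \<in> S \<Longrightarrow> open (U p) \<and> p \<in> U p \<and> bounded (f ` (U p \<inter> S))"
    by metis
  have "\<And>p. p \<in> K \<Longrightarrow> open (U p)" "K \<subseteq> (\<Union>p\<in>K. U p)"
    using U assms(3) by auto
  then obtain C where C: "C \<subseteq> K" "finite C" "K \<subseteq> (\<Union>p\<in>C. U p)"
    using compactE_image[OF assms(2)] by metis
  have "f ` K \<subseteq> (\<Union>p\<in>C. f ` (U p \<inter> S))"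
    using C(3) assms(3) by blast
  moreover have "bounded (\<Union>p\<in>C. f ` (U p \<inter> S))"
    using C(1,2) U assms(3) by (intro bounded_UN) auto
  ultimately show ?thesis
    by (rule bounded_subset[rotated])
qed

text \<open>The product is dominated by a constant multiple of \<open>L\<close>. Measurability of
  \<open>g\<close> is taken relative to \<open>S\<close> so that functions controlled only on a
  subinterval, such as \<open>\<epsilon> x y\<close>, are covered.\<close>

lemma integrable_mult_bounded_compose:
  fixes L :: "'t \<Rightarrow> real" and g :: "'b::topological_space \<Rightarrow> real"
  assumes L: "integrable \<mu> L"
    and m: "m \<in> borel_measurable \<mu>" "\<And>t. t \<in> space \<mu> \<Longrightarrow> m t \<in> S"
    and g: "g \<in> borel_measurable (restrict_space borel S)" "bounded (g ` S)"
  shows "integrable \<mu> (\<lambda>t. L t * g (m t))"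
proof -
  have "m \<in> measurable \<mu> (restrict_space borel S)"
    using m by (intro measurable_restrict_space2) auto
  then have gm: "(\<lambda>t. g (m t)) \<in> borel_measurable \<mu>"
    using g(1) by (rule measurable_compose)
  obtain B where "\<And>u. u \<in> S \<Longrightarrow> norm (g u) \<le> B"
    using g(2) by (auto simp: bounded_iff)
  then have B: "\<bar>g (m t)\<bar> \<le> \<bar>B\<bar>" if "t \<in> space \<mu>" for t
    using m(2)[OF that] by fastforce
  show ?thesis
  proof (rule Bochner_Integration.integrable_bound)
    show "integrable \<mu> (\<lambda>t. \<bar>B\<bar> * L t)"
      using L by simp
    show "(\<lambda>t. L t * g (m t)) \<in> borel_measurable \<mu>"
      using borel_measurable_integrable[OF L] gm by (rule borel_measurable_times)
    show "AE t in \<mu>. norm (L t * g (m t)) \<le> norm (\<bar>B\<bar> * L t)"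
    proof (rule AE_I2)
      fix t assume "t \<in> space \<mu>"
      then show "norm (L t * g (m t)) \<le> norm (\<bar>B\<bar> * L t)"
        using mult_left_mono[OF B abs_ge_zero, of t "L t"] by (simp add: abs_mult mult.commute)
    qed
  qed
qed

text \<open>Expanding both determinants and collecting the terms in
  \<open>\<omega>\<^sub>0 u\<close> and \<open>\<omega>\<^sub>1 u\<close> leaves coefficients free
  of \<open>u\<close>, which can later be pulled out of an integral.\<close>

lemma Omega_interpolation_eq:
  "Omega \<omega>\<^sub>0 \<omega>\<^sub>1 u y / W * p + Omega \<omega>\<^sub>0 \<omega>\<^sub>1 x u / W * q
     = (\<omega>\<^sub>1 y * p - \<omega>\<^sub>1 x * q) / W * \<omega>\<^sub>0 u + (\<omega>\<^sub>0 x * q - \<omega>\<^sub>0 y * p) / W * \<omega>\<^sub>1 u"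
  by (simp add: Omega_def diff_divide_distrib add_divide_distrib algebra_simps)

theorem theorem12:
  fixes I :: "real set"
    and \<mu> :: "'t measure"
    and \<Lambda> :: "'t \<Rightarrow> real \<Rightarrow> real \<Rightarrow> real"
    and M :: "'t \<Rightarrow> real \<Rightarrow> real \<Rightarrow> real"
    and M\<^sub>0 :: "real \<Rightarrow> real \<Rightarrow> real"
    and \<omega>\<^sub>0 \<omega>\<^sub>1 :: "real \<Rightarrow> real"
    and f :: "real \<Rightarrow> real"
    and \<epsilon> :: "real \<Rightarrow> real \<Rightarrow> real \<Rightarrow> real"
    and E :: "real \<Rightarrow> real \<Rightarrow> real"
  assumes I: "open I" "is_interval I" "I \<noteq> {}"
    and Lambda_nonneg:
      "\<And>t x y. t \<in> space \<mu> \<Longrightarrow> (x, y) \<in> open_triangle I \<Longrightarrow> \<Lambda> t x y \<ge> 0"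
    and Lambda_integrable:
      "\<And>x y. (x, y) \<in> open_triangle I \<Longrightarrow> integrable \<mu> (\<lambda>t. \<Lambda> t x y)"
    and M_measurable:
      "\<And>x y. (x, y) \<in> open_triangle I \<Longrightarrow> (\<lambda>t. M t x y) \<in> borel_measurable \<mu>"
    and M_mean: "\<And>t. t \<in> space \<mu> \<Longrightarrow> mean_on I (M t)"
    and M0_strict_mean: "strict_mean_on I M\<^sub>0"
    and chebyshev: "chebyshev_system_on I \<omega>\<^sub>0 \<omega>\<^sub>1"
    and omega0_pos: "\<And>x. x \<in> I \<Longrightarrow> \<omega>\<^sub>0 x > 0"
    and omega0_M0:
      "\<And>x y. (x, y) \<in> open_triangle I \<Longrightarrow>
         \<omega>\<^sub>0 (M\<^sub>0 x y) = (LINT t|\<mu>. \<Lambda> t x y * \<omega>\<^sub>0 (M t x y))"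
    and omega1_M0:
      "\<And>x y. (x, y) \<in> open_triangle I \<Longrightarrow>
         \<omega>\<^sub>1 (M\<^sub>0 x y) = (LINT t|\<mu>. \<Lambda> t x y * \<omega>\<^sub>1 (M t x y))"
    and f_locally_bounded: "locally_bounded_on I f"
    and f_measurable: "f \<in> borel_measurable (restrict_space borel I)"
    and eps_bounded:
      "\<And>x y. (x, y) \<in> open_triangle I \<Longrightarrow> bounded (\<epsilon> x y ` {x..y})"
    and eps_measurable:
      "\<And>x y. (x, y) \<in> open_triangle I \<Longrightarrow>
         \<epsilon> x y \<in> borel_measurable (restrict_space borel {x..y})"
    and f_approx_convex:
      "\<And>x y u. (x, y) \<in> open_triangle I \<Longrightarrow> u \<in> {x..y} \<Longrightarrow>
         f u \<le> Omega \<omega>\<^sub>0 \<omega>\<^sub>1 u y / Omega \<omega>\<^sub>0 \<omega>\<^sub>1 x y * f x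
             + Omega \<omega>\<^sub>0 \<omega>\<^sub>1 x u / Omega \<omega>\<^sub>0 \<omega>\<^sub>1 x y * f y + \<epsilon> x y u"
    and E_def:
      "\<And>x y. (x, y) \<in> open_triangle I \<Longrightarrow>
         E x y = (LINT t|\<mu>. \<Lambda> t x y * \<epsilon> x y (M t x y))"
  shows "\<forall>(x, y) \<in> open_triangle I.
           (LINT t|\<mu>. \<Lambda> t x y * f (M t x y))
             \<le> Omega \<omega>\<^sub>0 \<omega>\<^sub>1 (M\<^sub>0 x y) y / Omega \<omega>\<^sub>0 \<omega>\<^sub>1 x y * f x
               + Omega \<omega>\<^sub>0 \<omega>\<^sub>1 x (M\<^sub>0 x y) / Omega \<omega>\<^sub>0 \<omega>\<^sub>1 x y * f y + E x y"
proof (safe)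
  fix x y
  assume xy: "(x, y) \<in> open_triangle I"
  have sub: "{x..y} \<subseteq> I"
    using xy I(2) by (auto simp: open_triangle_def is_interval_1)
  have M_in: "M t x y \<in> {x..y}" if "t \<in> space \<mu>" for t
    using M_mean[OF that] xy by (auto simp: mean_on_def)
  \<comment> \<open>Here \<open>S\<close> becomes \<open>{x..y}\<close>, since every mean maps into
    it. Each function composed with \<open>M\<close> then only has to be Borel and bounded on this
    compact interval.\<close>
  note int = integrable_mult_bounded_compose[OF Lambda_integrable[OF xy] M_measurable[OF xy] M_in]
  have int_cont: "integrable \<mu> (\<lambda>t. \<Lambda> t x y * g (M t x y))" if "continuous_on I g" for g
  proof -
    have "continuous_on {x..y} g"
      using that sub by (rule continuous_on_subset)
    then show ?thesis
      by (intro int borel_measurable_continuous_on_restrict compact_imp_bounded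
          compact_continuous_image) auto
  qed
  have int_\<omega>: "integrable \<mu> (\<lambda>t. \<Lambda> t x y * \<omega>\<^sub>0 (M t x y))"
    "integrable \<mu> (\<lambda>t. \<Lambda> t x y * \<omega>\<^sub>1 (M t x y))"
    using chebyshev by (auto simp: chebyshev_system_on_def intro: int_cont)
  \<comment> \<open>Measurability of \<open>f\<close> passes from \<open>I\<close> to the
    subinterval \<open>{x..y}\<close>; its boundedness there comes from compactness.\<close>
  have "f \<in> borel_measurable (restrict_space borel {x..y})"
    using measurable_restrict_mono[OF f_measurable sub] .
  then have int_f: "integrable \<mu> (\<lambda>t. \<Lambda> t x y * f (M t x y))"
    using locally_bounded_on_compact_imp_bounded[OF f_locally_bounded compact_Icc sub]
    by (intro int)
  have int_\<epsilon>: "integrable \<mu> (\<lambda>t. \<Lambda> t x y * \<epsilon> x y (M t x y))"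
    using xy by (intro int eps_measurable eps_bounded)
  \<comment> \<open>With these coefficients,
    \<open>a * \<omega>\<^sub>0 u + b * \<omega>\<^sub>1 u\<close> is the generalized chord of
    \<open>f\<close>: it takes the values \<open>f x\<close> at \<open>x\<close> and
    \<open>f y\<close> at \<open>y\<close>.\<close>
  define a where "a = (\<omega>\<^sub>1 y * f x - \<omega>\<^sub>1 x * f y) / Omega \<omega>\<^sub>0 \<omega>\<^sub>1 x y"
  define b where "b = (\<omega>\<^sub>0 x * f y - \<omega>\<^sub>0 y * f x) / Omega \<omega>\<^sub>0 \<omega>\<^sub>1 x y"
  have interp: "Omega \<omega>\<^sub>0 \<omega>\<^sub>1 u y / Omega \<omega>\<^sub>0 \<omega>\<^sub>1 x y * f x
      + Omega \<omega>\<^sub>0 \<omega>\<^sub>1 x u / Omega \<omega>\<^sub>0 \<omega>\<^sub>1 x y * f y = a * \<omega>\<^sub>0 u + b * \<omega>\<^sub>1 u" for u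
    unfolding a_def b_def by (rule Omega_interpolation_eq)
  \<comment> \<open>The chord is split with \<open>a\<close> and \<open>b\<close> in front, so that
    linearity yields exactly the integrals occurring in the equations for
    \<open>M\<^sub>0\<close>.\<close>
  have "(LINT t|\<mu>. \<Lambda> t x y * f (M t x y))
      \<le> (LINT t|\<mu>. a * (\<Lambda> t x y * \<omega>\<^sub>0 (M t x y)) + b * (\<Lambda> t x y * \<omega>\<^sub>1 (M t x y))
           + \<Lambda> t x y * \<epsilon> x y (M t x y))"
  proof (rule integral_mono[OF int_f])
    show "integrable \<mu> (\<lambda>t. a * (\<Lambda> t x y * \<omega>\<^sub>0 (M t x y)) + b * (\<Lambda> t x y * \<omega>\<^sub>1 (M t x y))
        + \<Lambda> t x y * \<epsilon> x y (M t x y))"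
      using int_\<omega> int_\<epsilon> by simp
  next
    fix t assume t: "t \<in> space \<mu>"
    \<comment> \<open>This is approximate convexity at the point \<open>u = M t x y\<close>, its
      chord rewritten by \<open>interp\<close>; the weight is nonnegative and keeps the
      direction.\<close>
    have "\<Lambda> t x y * f (M t x y)
        \<le> \<Lambda> t x y * (a * \<omega>\<^sub>0 (M t x y) + b * \<omega>\<^sub>1 (M t x y) + \<epsilon> x y (M t x y))"
      using f_approx_convex[OF xy M_in[OF t]] Lambda_nonneg[OF t xy]
      unfolding interp by (rule mult_left_mono)
    then show "\<Lambda> t x y * f (M t x y)
        \<le> a * (\<Lambda> t x y * \<omega>\<^sub>0 (M t x y)) + b * (\<Lambda> t x y * \<omega>\<^sub>1 (M t x y))
           + \<Lambda> t x y * \<epsilon> x y (M t x y)"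
      by (simp add: algebra_simps)
  qed
  also have "\<dots> = a * \<omega>\<^sub>0 (M\<^sub>0 x y) + b * \<omega>\<^sub>1 (M\<^sub>0 x y) + E x y"
    using int_\<omega> int_\<epsilon> by (simp add: omega0_M0[OF xy] omega1_M0[OF xy] E_def[OF xy])
  \<comment> \<open>The same identity \<open>interp\<close>, now at
    \<open>u = M\<^sub>0 x y\<close>, turns the chord back into its determinant form.\<close>
  finally show "(LINT t|\<mu>. \<Lambda> t x y * f (M t x y))
      \<le> Omega \<omega>\<^sub>0 \<omega>\<^sub>1 (M\<^sub>0 x y) y / Omega \<omega>\<^sub>0 \<omega>\<^sub>1 x y * f x
        + Omega \<omega>\<^sub>0 \<omega>\<^sub>1 x (M\<^sub>0 x y) / Omega \<omega>\<^sub>0 \<omega>\<^sub>1 x y * f y + E x y"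
    unfolding interp .
qed

end
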